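(* a) The lattice $\mathcal P_1(\mathbb R)$ endowed with the lattice order $\leq_{\rm icv}$ is Dedekind super complete, and so is $\mathcal P_1(\mathbb R)$ endowed with the lattice order $\leq_{\rm icx}$. b) Let $M\subset\mathcal P_1(\mathbb R)$ be nonempty, bounded below with respect to $\leq_{\rm icv}$ and bounded above with respect to $\leq_{\rm icx}$. Let $\preceq$ be one of the two orders $\leq_{\rm icv}$, $\leq_{\rm icx}$. If $M$ is directed upwards (respectively downwards) with respect to $\preceq$, then there exists a sequence $(\mu^n)_{n\in\mathbb N}\subset M$, nondecreasing (respectively nonincreasing) with respect to $\preceq$, such that $\mu^n\to\mu$ in the Wasserstein-$1$ topology as $n\to\infty$, where $\mu\in\mathcal P_1(\mathbb R)$ is the supremum (respectively infimum) of $M$ with respect to $\preceq$.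
   Context: $\mathcal P_1(\mathbb R)$ is the set of all Borel probability measures $\mu$ on $\mathbb R$ with $\int_{\mathbb R}|x|\,d\mu(x)<\infty$, endowed with the Wasserstein-$1$ metric and topology. For $\mu\in\mathcal P_1(\mathbb R)$ and $s\in\mathbb R$ set $$\mu_{1,-}(s):=\int_{\mathbb R}\min\{x-s,0\}\,d\mu(x)=-\int_{-\infty}^s\mu((-\infty,u])\,du,\qquad \mu_{1,+}(s):=\int_{\mathbb R}\max\{x-s,0\}\,d\mu(x)=\int_s^\infty\mu((u,\infty))\,du .$$ The increasing concave order (second order stochastic dominance) is $\mu\leq_{\rm icv}\nu$ iff $\mu_{1,-}(s)\leq\nu_{1,-}(s)$ for all $s\in\mathbb R$; the increasing convex order is $\mu\leq_{\rm icx}\nu$ iff $\mu_{1,+}(s)\leq\nu_{1,+}(s)$ for all $s\in\mathbb R$. Both are lattice orders on $\mathcal P_1(\mathbb R)$. A lattice $L$ is Dedekind super complete if every nonempty subset of $L$ that is bounded above (respectively below) has a least upper bound (respectively greatest lower bound) and has a countable subset with the same least upper bound (respectively greatest lower bound). A subset $M$ of a lattice is directed upwards (respectively downwards) if for all $x,y\in M$ there is $z\in M$ with $x\vee y\leq z$ (respectively $x\wedge y\geq z$). *)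

theory Defs
  imports "HOL-Probability.Probability" "HOL-Algebra.Lattice"
begin

definition P1 :: "real measure set" where
  "P1 = {\<mu>. real_distribution \<mu> \<and> integrable \<mu> (\<lambda>x. \<bar>x\<bar>)}"

definition lower_part :: "real measure \<Rightarrow> real \<Rightarrow> real" where
  "lower_part \<mu> s = (\<integral>x. min (x - s) 0 \<partial>\<mu>)"

definition upper_part :: "real measure \<Rightarrow> real \<Rightarrow> real" where
  "upper_part \<mu> s = (\<integral>x. max (x - s) 0 \<partial>\<mu>)"

definition icv :: "real measure gorder" where
  "icv = \<lparr>carrier = P1, eq = (=), le = (\<lambda>\<mu> \<nu>. \<forall>s. lower_part \<mu> s \<le> lower_part \<nu> s)\<rparr>"

definition icx :: "real measure gorder" where
  "icx = \<lparr>carrier = P1, eq = (=), le = (\<lambda>\<mu> \<nu>. \<forall>s. upper_part \<mu> s \<le> upper_part \<nu> s)\<rparr>"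

definition couplings :: "real measure \<Rightarrow> real measure \<Rightarrow> (real \<times> real) measure set" where
  "couplings \<mu> \<nu> = {\<pi>. prob_space \<pi> \<and> sets \<pi> = sets (borel \<Otimes>\<^sub>M borel) \<and>
     distr \<pi> borel fst = \<mu> \<and> distr \<pi> borel snd = \<nu>}"

text \<open>The Wasserstein-1 metric is taken with values in \<^typ>\<open>ennreal\<close>, so that the integral and the
  infimum are total; it is finite on \<^const>\<open>P1\<close>.\<close>

definition W1 :: "real measure \<Rightarrow> real measure \<Rightarrow> ennreal" where
  "W1 \<mu> \<nu> = (INF \<pi>\<in>couplings \<mu> \<nu>. \<integral>\<^sup>+(x, y). ennreal \<bar>x - y\<bar> \<partial>\<pi>)"

definition W1_tendsto :: "(nat \<Rightarrow> real measure) \<Rightarrow> real measure \<Rightarrow> bool" where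
  "W1_tendsto m \<mu> \<longleftrightarrow> (\<lambda>n. W1 (m n) \<mu>) \<longlonglongrightarrow> 0"

definition bdd_above_in :: "'a gorder \<Rightarrow> 'a set \<Rightarrow> bool" where
  "bdd_above_in L A \<longleftrightarrow> Upper L A \<noteq> {}"

definition bdd_below_in :: "'a gorder \<Rightarrow> 'a set \<Rightarrow> bool" where
  "bdd_below_in L A \<longleftrightarrow> Lower L A \<noteq> {}"

definition dedekind_super_complete :: "'a gorder \<Rightarrow> bool" where
  "dedekind_super_complete L \<longleftrightarrow> lattice L \<and>
     (\<forall>A. A \<subseteq> carrier L \<and> A \<noteq> {} \<and> bdd_above_in L A \<longrightarrow>
        (\<exists>s. least L s (Upper L A) \<and> (\<exists>C\<subseteq>A. countable C \<and> least L s (Upper L C)))) \<and>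
     (\<forall>A. A \<subseteq> carrier L \<and> A \<noteq> {} \<and> bdd_below_in L A \<longrightarrow>
        (\<exists>s. greatest L s (Lower L A) \<and> (\<exists>C\<subseteq>A. countable C \<and> greatest L s (Lower L C))))"

definition directed_up :: "'a gorder \<Rightarrow> 'a set \<Rightarrow> bool" where
  "directed_up L M \<longleftrightarrow> (\<forall>x\<in>M. \<forall>y\<in>M. \<exists>z\<in>M. le L (join L x y) z)"

definition directed_down :: "'a gorder \<Rightarrow> 'a set \<Rightarrow> bool" where
  "directed_down L M \<longleftrightarrow> (\<forall>x\<in>M. \<forall>y\<in>M. \<exists>z\<in>M. le L z (meet L x y))"

end

(* Both orders are pointwise orders of convex functions: the increasing convex order compares the
   potentials E (x - s)^+, and the increasing concave order is dual to the comparison of the potentials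
   E (s - x)^+. A convex function lying between two potentials is a potential, its right derivative
   being a distribution function; so pointwise suprema of bounded families of potentials are
   potentials, and infima are suprema of lower bounds. Since potentials are continuous, domination
   only has to be tested on rational points, where countably many members of the family suffice.
   A directed set then contains a monotone sequence with the same extremum whose potentials converge
   pointwise. The bound in the other order makes the tails uniformly small, so the means and hence both
   potentials converge, which amounts to weak convergence together with convergence of first moments. *)
theory Submission
  imports Defs "HOL-Real_Asymp.Real_Asymp"
begin

section \<open>Potentials of probability measures\<close>

text \<open>This is the integrated distribution function of \<open>\<mu>\<close>. With the sign of
  \<open>lower_part\<close> reversed it is nonnegative and convex, so both orders become pointwise
  comparisons of convex functions.\<close>

definition lower_pot :: "real measure \<Rightarrow> real \<Rightarrow> real" where
  "lower_pot \<mu> s = (\<integral>x. max (s - x) 0 \<partial>\<mu>)"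

lemma lower_part_eq: "lower_part \<mu> s = - lower_pot \<mu> s"
proof -
  have "min (x - s) 0 = - max (s - x) 0" for x by (simp add: min_def max_def)
  then show ?thesis by (simp add: lower_part_def lower_pot_def)
qed

lemma P1_D:
  assumes "\<mu> \<in> P1"
  shows "real_distribution \<mu>" "prob_space \<mu>" "sets \<mu> = sets borel"
    and "integrable \<mu> (\<lambda>x. x)" "integrable \<mu> (\<lambda>x. \<bar>x\<bar>)"
    and "integrable \<mu> (\<lambda>x. max (s - x) 0)" "integrable \<mu> (\<lambda>x. max (x - s) 0)"
    and "integral\<^sup>L \<mu> (\<lambda>_. c :: real) = c"
proof -
  show rd: "real_distribution \<mu>" and int: "integrable \<mu> (\<lambda>x. \<bar>x\<bar>)"
    using assms by (auto simp: P1_def)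
  interpret real_distribution \<mu> by (rule rd)
  show "prob_space \<mu>" "sets \<mu> = sets borel" "integral\<^sup>L \<mu> (\<lambda>_. c) = c"
    using prob_space_axioms prob_space by auto
  show *: "integrable \<mu> (\<lambda>x. x)"
    using int by (rule integrable_abs_cancel) simp
  show "integrable \<mu> (\<lambda>x. max (s - x) 0)" "integrable \<mu> (\<lambda>x. max (x - s) 0)"
    using * by (auto intro!: integrable_max)
qed

text \<open>Integrate \<open>max (x - s) 0 = max (s - x) 0 + x - s\<close>. The two potentials
  differ by an affine function fixed by the mean, which is how information passes from one order to
  the other.\<close>

lemma upper_part_eq:
  assumes "\<mu> \<in> P1"
  shows "upper_part \<mu> s = lower_pot \<mu> s + (\<integral>x. x \<partial>\<mu>) - s"
proof -
  note I = P1_D[OF assms]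
  interpret prob_space \<mu> by (rule I)
  have "upper_part \<mu> s = (\<integral>x. max (s - x) 0 + x - s \<partial>\<mu>)"
    unfolding upper_part_def by (rule Bochner_Integration.integral_cong) (auto simp: max_def)
  also have "\<dots> = lower_pot \<mu> s + (\<integral>x. x \<partial>\<mu>) - s"
    unfolding lower_pot_def using I by (simp add: I(8))
  finally show ?thesis .
qed

lemma lower_pot_nonneg: "0 \<le> lower_pot \<mu> s"
  and upper_part_nonneg: "0 \<le> upper_part \<mu> s"
  unfolding lower_pot_def upper_part_def by (auto intro!: integral_nonneg_AE)

text \<open>The difference is bounded by \<open>\<bar>t - s\<bar>\<close>, hence integrable even
  when the single terms are not known to be; \<open>lower_pot_exists\<close> works with such
  differences before the first moment is known to be finite.\<close>

lemma (in real_distribution) integrable_max_diff: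
  "integrable M (\<lambda>x. max (t - x) 0 - max (s - x) (0::real))"
  by (rule integrable_const_bound[where B = "\<bar>t - s\<bar>"]) (auto simp: max_def)

text \<open>The integrand lies between \<open>t - s\<close> times the indicators of
  \<open>{..s}\<close> and \<open>{..t}\<close>. These slope bounds tie a potential to its
  distribution function in everything that follows.\<close>

lemma (in real_distribution) integral_max_diff_bounds:
  assumes "s \<le> t"
  shows "(t - s) * cdf M s \<le> (\<integral>x. max (t - x) 0 - max (s - x) 0 \<partial>M)"
    and "(\<integral>x. max (t - x) 0 - max (s - x) 0 \<partial>M) \<le> (t - s) * cdf M t"
proof -
  have cdf: "(t - s) * cdf M u = (\<integral>x. (t - s) * indicator {..u} x \<partial>M)" for u
    by (simp add: cdf_def)
  have int: "integrable M (\<lambda>x. (t - s) * indicator {..u} x)" for u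
    by (intro integrable_mult_right integrable_real_indicator) (auto simp: emeasure_finite less_top[symmetric])
  show "(t - s) * cdf M s \<le> (\<integral>x. max (t - x) 0 - max (s - x) 0 \<partial>M)"
    unfolding cdf using assms
    by (intro integral_mono int integrable_max_diff) (auto simp: max_def indicator_def)
  show "(\<integral>x. max (t - x) 0 - max (s - x) 0 \<partial>M) \<le> (t - s) * cdf M t"
    unfolding cdf using assms
    by (intro integral_mono int integrable_max_diff) (auto simp: max_def indicator_def)
qed

lemma lower_pot_diff_bounds:
  assumes "\<mu> \<in> P1" "s \<le> t"
  shows "(t - s) * cdf \<mu> s \<le> lower_pot \<mu> t - lower_pot \<mu> s"
    and "lower_pot \<mu> t - lower_pot \<mu> s \<le> (t - s) * cdf \<mu> t"
proof -
  have "lower_pot \<mu> t - lower_pot \<mu> s = (\<integral>x. max (t - x) 0 - max (s - x) 0 \<partial>\<mu>)"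
    unfolding lower_pot_def using P1_D[OF assms(1)] by simp
  then show "(t - s) * cdf \<mu> s \<le> lower_pot \<mu> t - lower_pot \<mu> s"
    and "lower_pot \<mu> t - lower_pot \<mu> s \<le> (t - s) * cdf \<mu> t"
    using real_distribution.integral_max_diff_bounds[OF P1_D(1)[OF assms(1)] assms(2)] by simp_all
qed

lemma lower_pot_ge:
  assumes "\<mu> \<in> P1"
  shows "s - (\<integral>x. x \<partial>\<mu>) \<le> lower_pot \<mu> s"
  using upper_part_eq[OF assms, of s] upper_part_nonneg[of \<mu> s] by simp

lemma lower_pot_le:
  assumes "\<mu> \<in> P1" "0 \<le> s"
  shows "lower_pot \<mu> s \<le> s + lower_pot \<mu> 0"
proof -
  interpret real_distribution \<mu> by (rule P1_D[OF assms(1)])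
  have "s * cdf \<mu> s \<le> s" using cdf_bounded_prob[of s] assms(2) by (simp add: mult_left_le)
  then show ?thesis using lower_pot_diff_bounds(2)[OF assms] by simp
qed

lemma lower_pot_convex:
  assumes "\<mu> \<in> P1"
  shows "convex_on UNIV (lower_pot \<mu>)"
proof (rule convex_onI)
  fix t x y :: real assume t: "0 < t" "t < 1"
  note I = P1_D[OF assms]
  have pt: "max ((1 - t) * x + t * y - z) 0 \<le> (1 - t) * max (x - z) 0 + t * max (y - z) 0" for z
  proof -
    have "(1 - t) * (x - z) \<le> (1 - t) * max (x - z) 0" "t * (y - z) \<le> t * max (y - z) 0"
      using t by (auto intro!: mult_left_mono)
    moreover have "0 \<le> (1 - t) * max (x - z) 0" "0 \<le> t * max (y - z) 0" using t by auto
    moreover have "(1 - t) * x + t * y - z = (1 - t) * (x - z) + t * (y - z)" by (simp add: algebra_simps)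
    ultimately show ?thesis by (metis add_mono add_nonneg_nonneg max.bounded_iff)
  qed
  have "lower_pot \<mu> ((1 - t) * x + t * y) \<le> (\<integral>z. (1 - t) * max (x - z) 0 + t * max (y - z) 0 \<partial>\<mu>)"
    unfolding lower_pot_def using I pt by (intro integral_mono) auto
  also have "\<dots> = (1 - t) * lower_pot \<mu> x + t * lower_pot \<mu> y"
    unfolding lower_pot_def using I by simp
  finally show "lower_pot \<mu> ((1 - t) *\<^sub>R x + t *\<^sub>R y) \<le> (1 - t) * lower_pot \<mu> x + t * lower_pot \<mu> y"
    by simp
qed simp

lemma upper_part_at_top:
  assumes "\<mu> \<in> P1"
  shows "(upper_part \<mu> \<longlongrightarrow> 0) at_top"
proof -
  note I = P1_D[OF assms]
  note [measurable_cong] = I(3)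
  have "((\<lambda>s. \<integral>x. max (x - s) 0 \<partial>\<mu>) \<longlongrightarrow> (\<integral>x. 0 \<partial>\<mu>)) at_top"
  proof (rule integral_dominated_convergence_at_top[where w = "\<lambda>x. \<bar>x\<bar>"])
    show "\<forall>\<^sub>F s in at_top. AE x in \<mu>. norm (max (x - s) 0) \<le> \<bar>x\<bar>"
      using eventually_ge_at_top[of 0] by eventually_elim (auto simp: max_def)
    have "((\<lambda>s. max (x - s) 0) \<longlongrightarrow> 0) at_top" for x :: real
      by (rule tendsto_eventually) (use eventually_ge_at_top[of x] in eventually_elim, auto)
    then show "AE x in \<mu>. ((\<lambda>s. max (x - s) 0) \<longlongrightarrow> 0) at_top" by simp
  qed (use I(5) in simp_all)
  then show ?thesis by (simp add: upper_part_def[abs_def])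
qed

section \<open>Reflection\<close>

text \<open>Reflection exchanges the two potentials up to replacing \<open>s\<close> by
  \<open>- s\<close>, so facts about \<open>lower_pot\<close> carry over to
  \<open>upper_part\<close>.\<close>

definition reflect :: "real measure \<Rightarrow> real measure" where
  "reflect \<mu> = distr \<mu> borel uminus"

lemma reflect_P1:
  assumes "\<mu> \<in> P1"
  shows "reflect \<mu> \<in> P1" "reflect (reflect \<mu>) = \<mu>"
    and lower_pot_reflect: "lower_pot (reflect \<mu>) s = upper_part \<mu> (- s)"
    and upper_part_reflect: "upper_part (reflect \<mu>) s = lower_pot \<mu> (- s)"
proof -
  note I = P1_D[OF assms]
  note [measurable_cong] = I(3)
  have [measurable]: "uminus \<in> measurable \<mu> borel" by measurable
  interpret prob_space \<mu> by (rule I)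
  have "real_distribution (reflect \<mu>)"
    unfolding reflect_def by (rule real_distribution_distr) measurable
  moreover have "integrable (reflect \<mu>) (\<lambda>x. \<bar>x\<bar>)"
    unfolding reflect_def using I(5) by (subst integrable_distr_eq) auto
  ultimately show "reflect \<mu> \<in> P1" by (simp add: P1_def)
  show "reflect (reflect \<mu>) = \<mu>"
    unfolding reflect_def by (subst distr_distr) (auto simp: o_def I(3) intro!: distr_id2)
  show "lower_pot (reflect \<mu>) s = upper_part \<mu> (- s)"
    unfolding lower_pot_def reflect_def upper_part_def
    by (subst integral_distr) (auto simp: add.commute)
  show "upper_part (reflect \<mu>) s = lower_pot \<mu> (- s)"
    unfolding lower_pot_def reflect_def upper_part_def
    by (subst integral_distr) (auto simp: minus_diff_commute)
qed

lemma lower_pot_at_bot: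
  assumes "\<mu> \<in> P1"
  shows "(lower_pot \<mu> \<longlongrightarrow> 0) at_bot"
proof -
  have "((\<lambda>s. upper_part (reflect \<mu>) (- s)) \<longlongrightarrow> 0) at_bot"
    by (rule filterlim_compose[OF upper_part_at_top filterlim_uminus_at_top_at_bot])
      (simp add: reflect_P1 assms)
  then show ?thesis by (simp add: upper_part_reflect[OF assms])
qed

section \<open>Convex functions that are potentials\<close>

text \<open>On a subdivision into pieces of length \<open>h\<close>, each increment of
  \<open>f - g\<close> is at most \<open>h\<close> times the increment of \<open>F\<close>; the sum
  telescopes to \<open>h * (F v - F u)\<close> and vanishes as the mesh shrinks.\<close>

lemma increments_eq:
  fixes f g F :: "real \<Rightarrow> real"
  assumes f: "\<And>s t. s \<le> t \<Longrightarrow> (t - s) * F s \<le> f t - f s" "\<And>s t. s \<le> t \<Longrightarrow> f t - f s \<le> (t - s) * F t"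
    and g: "\<And>s t. s \<le> t \<Longrightarrow> (t - s) * F s \<le> g t - g s" "\<And>s t. s \<le> t \<Longrightarrow> g t - g s \<le> (t - s) * F t"
  shows "f b - f a = g b - g a"
proof -
  define d where "d t = f t - g t" for t
  have d: "\<bar>d t - d s\<bar> \<le> (t - s) * (F t - F s)" if "s \<le> t" for s t
  proof -
    have "(t - s) * (F t - F s) = (t - s) * F t - (t - s) * F s" by (rule right_diff_distrib)
    with f[OF that] g[OF that] show ?thesis by (simp add: d_def abs_le_iff)
  qed
  have eq: "d v = d u" if "u \<le> v" for u v
  proof -
    have bnd: "\<bar>d v - d u\<bar> \<le> (v - u) * (F v - F u) / real (Suc n)" for n
    proof -
      define h where "h = (v - u) / real (Suc n)"
      define x where "x i = u + real i * h" for i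
      have h: "0 \<le> h" using that by (simp add: h_def)
      have x0: "x 0 = u" and xn: "x (Suc n) = v" by (simp_all add: x_def h_def field_simps)
      have step: "x (Suc i) - x i = h" for i by (simp add: x_def algebra_simps)
      have "\<bar>d v - d u\<bar> = \<bar>\<Sum>i<Suc n. d (x (Suc i)) - d (x i)\<bar>"
        using sum_lessThan_telescope[of "\<lambda>i. d (x i)" "Suc n"] by (simp only: x0 xn)
      also have "\<dots> \<le> (\<Sum>i<Suc n. h * (F (x (Suc i)) - F (x i)))"
      proof (rule order_trans[OF sum_abs], rule sum_mono)
        fix i show "\<bar>d (x (Suc i)) - d (x i)\<bar> \<le> h * (F (x (Suc i)) - F (x i))"
          using d[of "x i" "x (Suc i)"] step[of i] h by simp
      qed
      also have "\<dots> = h * (F v - F u)"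
        using sum_lessThan_telescope[of "\<lambda>i. F (x i)" "Suc n"]
        by (simp only: sum_distrib_left[symmetric] x0 xn)
      finally show ?thesis by (simp add: h_def)
    qed
    have "(\<lambda>n. (v - u) * (F v - F u) / real (Suc n)) \<longlonglongrightarrow> 0"
      by real_asymp
    then have "\<bar>d v - d u\<bar> \<le> 0"
      by (rule tendsto_lowerbound) (use bnd in auto)
    then show ?thesis by simp
  qed
  have "d b = d a" using eq[of a b] eq[of b a] by (cases "a \<le> b") auto
  then show ?thesis by (simp add: d_def)
qed

text \<open>The common slope over \<open>[s, t]\<close> is at least one distribution function at
  \<open>s\<close> and at most the other at \<open>t\<close>; right continuity lets \<open>t\<close>
  decrease to \<open>s\<close>. By symmetry the distribution functions agree.\<close>

lemma lower_pot_inj: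
  assumes "\<mu> \<in> P1" "\<nu> \<in> P1" "lower_pot \<mu> = lower_pot \<nu>"
  shows "\<mu> = \<nu>"
proof -
  have le: "cdf \<mu> s \<le> cdf \<nu> s"
    if P: "\<mu> \<in> P1" "\<nu> \<in> P1" "lower_pot \<mu> = lower_pot \<nu>" for \<mu> \<nu> s
  proof -
    interpret n: real_distribution \<nu> by (rule P1_D[OF P(2)])
    have "cdf \<mu> s \<le> cdf \<nu> t" if "s < t" for t
    proof (rule mult_left_le_imp_le)
      show "(t - s) * cdf \<mu> s \<le> (t - s) * cdf \<nu> t"
        by (rule order_trans[OF lower_pot_diff_bounds(1)[OF P(1), of s t, unfolded P(3)]
              lower_pot_diff_bounds(2)[OF P(2), of s t]]) (use that in simp_all)
      show "0 < t - s" using that by simp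
    qed
    then have "\<forall>\<^sub>F t in at_right s. cdf \<mu> s \<le> cdf \<nu> t"
      by (auto simp: eventually_at_filter)
    moreover have "(cdf \<nu> \<longlongrightarrow> cdf \<nu> s) (at_right s)"
      using n.cdf_is_right_cont[of s] by (simp add: continuous_within)
    ultimately show ?thesis
      by (intro tendsto_lowerbound) auto
  qed
  show ?thesis
    by (rule cdf_unique) (use assms le[of \<mu> \<nu>] le[of \<nu> \<mu>] in \<open>auto intro!: antisym P1_D simp: fun_eq_iff\<close>)
qed

text \<open>This bounds the forward quotients from below, so that their infimum, the right
  derivative in \<open>lower_pot_exists\<close>, is finite.\<close>

lemma convex_on_slopes:
  fixes f :: "real \<Rightarrow> real"
  assumes "convex_on UNIV f" "0 < h" "0 < k"
  shows "(f s - f (s - h)) / h \<le> (f (s + k) - f s) / k"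
proof -
  have "(f (s - h) - f s) / ((s - h) - s) \<le> (f s - f (s + k)) / (s - (s + k))"
    using convex_on_slope_le[OF assms(1), of "s - h" "s + k" s] assms by simp
  then show ?thesis by (simp add: minus_divide_right[symmetric] minus_divide_left)
qed

text \<open>The distribution function of the measure is the right derivative of \<^term>\<open>f\<close>; as an infimum
  of continuous difference quotients it is upper semicontinuous, hence right continuous.\<close>

lemma lower_pot_exists:
  fixes f :: "real \<Rightarrow> real"
  assumes convex: "convex_on UNIV f"
    and bot: "(f \<longlongrightarrow> 0) at_bot"
    and ge: "\<And>s. s - B \<le> f s"
    and le: "\<And>s. 0 \<le> s \<Longrightarrow> f s \<le> s + K"
  shows "\<exists>\<mu>\<in>P1. lower_pot \<mu> = f"
proof -
  define F where "F s = (INF h\<in>{0<..}. (f (s + h) - f s) / h)" for s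
  have "bdd_below ((\<lambda>h. (f (s + h) - f s) / h) ` {0<..})" for s
    by (rule bdd_belowI2[where m = "(f s - f (s - 1)) / 1"])
      (use convex_on_slopes[OF convex, of 1] in auto)
  note bdd = this
  have F_le: "F s \<le> (f (s + h) - f s) / h" if "0 < h" for s h
    unfolding F_def using bdd that by (auto intro!: cINF_lower)
  have F_ge: "(f s - f (s - h)) / h \<le> F s" if "0 < h" for s h
    unfolding F_def using convex_on_slopes[OF convex] that by (auto intro!: cINF_greatest)
  have f1: "(t - s) * F s \<le> f t - f s" if "s \<le> t" for s t
    using F_le[of "t - s" s] that by (cases "s = t") (auto simp: field_simps)
  have f2: "f t - f s \<le> (t - s) * F t" if "s \<le> t" for s t
    using F_ge[of "t - s" t] that by (cases "s = t") (auto simp: field_simps)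
  have mono: "F s \<le> F t" if "s \<le> t" for s t
    using F_le[of "t - s" s] F_ge[of "t - s" t] that by (cases "s = t") auto
  have cont: "continuous_on UNIV f"
    by (rule convex_on_continuous) (auto simp: convex)
  have rcont: "continuous (at_right a) F" for a
    unfolding continuous_within
  proof (rule order_tendstoI)
    fix y assume "y < F a"
    then show "\<forall>\<^sub>F x in at_right a. y < F x"
      by (intro eventually_at_rightI[of a "a + 1"]) (use mono in \<open>auto intro: less_le_trans\<close>)
  next
    fix y assume "F a < y"
    then obtain h where h: "0 < h" "(f (a + h) - f a) / h < y"
      unfolding F_def using cINF_less_iff[OF _ bdd] by auto
    have "((\<lambda>x. (f (x + h) - f x) / h) \<longlongrightarrow> (f (a + h) - f a) / h) (at_right a)"
      using h(1) by (intro tendsto_intros continuous_on_tendsto_compose[OF cont]) auto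
    then have "\<forall>\<^sub>F x in at_right a. (f (x + h) - f x) / h < y"
      using h(2) by (rule order_tendstoD)
    then show "\<forall>\<^sub>F x in at_right a. F x < y"
      by eventually_elim (use F_le[OF h(1)] in \<open>auto intro: le_less_trans\<close>)
  qed
  have F_bot: "(F \<longlongrightarrow> 0) at_bot"
  proof (rule tendsto_sandwich)
    show "\<forall>\<^sub>F s in at_bot. f s - f (s - 1) \<le> F s" using F_ge[of 1] by auto
    show "\<forall>\<^sub>F s in at_bot. F s \<le> f (s + 1) - f s" using F_le[of 1] by auto
    have "((\<lambda>s. f (s - 1)) \<longlongrightarrow> 0) at_bot" "((\<lambda>s. f (s + 1)) \<longlongrightarrow> 0) at_bot"
      by (rule filterlim_compose[OF bot], real_asymp)+
    then show "((\<lambda>s. f s - f (s - 1)) \<longlongrightarrow> 0) at_bot" "((\<lambda>s. f (s + 1) - f s) \<longlongrightarrow> 0) at_bot"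
      using bot by (auto intro!: tendsto_eq_intros)
  qed
  have F_top: "(F \<longlongrightarrow> 1) at_top"
  proof (rule tendsto_sandwich)
    show "\<forall>\<^sub>F s in at_top. (s - B - f 0) / s \<le> F s"
      using eventually_gt_at_top[of 0]
    proof eventually_elim
      case (elim s)
      \<comment> \<open>The backward quotient with step \<open>s\<close> is the chord slope over
        \<open>[0, s]\<close>; the lower growth bound on \<open>f\<close> forces it up to 1.\<close>
      have "(s - B - f 0) / s \<le> (f s - f (s - s)) / s"
        using ge[of s] elim by (intro divide_right_mono) auto
      then show ?case using F_ge[OF elim, of s] by simp
    qed
    show "\<forall>\<^sub>F s in at_top. F s \<le> 1"
      using eventually_ge_at_top[of 0]
    proof eventually_elim
      case (elim s)
      \<comment> \<open>With \<open>s\<close> fixed, the two growth bounds cap the chord slope over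
        \<open>[s, s + h]\<close>; letting \<open>h\<close> tend to infinity leaves 1.\<close>
      have "((\<lambda>h. (h + (K + B)) / h) \<longlongrightarrow> 1) at_top" by real_asymp
      moreover have "\<forall>\<^sub>F h in at_top. F s \<le> (h + (K + B)) / h"
        using eventually_gt_at_top[of 0]
      proof eventually_elim
        case h: (elim h)
        have "(f (s + h) - f s) / h \<le> (h + (K + B)) / h"
          using ge[of s] le[of "s + h"] elim h by (intro divide_right_mono) auto
        then show ?case using F_le[OF h, of s] by simp
      qed
      ultimately show ?case by (rule tendsto_lowerbound) simp
    qed
    show "((\<lambda>s. (s - B - f 0) / s) \<longlongrightarrow> 1) at_top" by real_asymp
  qed simp
  define \<mu> where "\<mu> = interval_measure F"
  have rd: "real_distribution \<mu>" and cdf: "cdf \<mu> = F"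
    unfolding \<mu>_def using mono rcont F_bot F_top
    by (auto intro!: real_distribution_interval_measure cdf_interval_measure)
  interpret real_distribution \<mu> by (rule rd)
  \<comment> \<open>Subtracting the term at 0 keeps the integrand bounded, so \<open>G\<close> is
    meaningful although the potential of \<open>\<mu>\<close> is not yet known to be finite.\<close>
  define G where "G s = (\<integral>x. max (s - x) 0 - max (0 - x) 0 \<partial>\<mu>)" for s
  have G_diff: "G t - G s = (\<integral>x. max (t - x) 0 - max (s - x) 0 \<partial>\<mu>)" for s t
    unfolding G_def by (subst Bochner_Integration.integral_diff[symmetric]) (rule integrable_max_diff, rule integrable_max_diff, simp)
  have G: "(\<integral>x. max (t - x) 0 - max (s - x) 0 \<partial>\<mu>) = f t - f s" for s t
    unfolding G_diff[symmetric]
    by (rule increments_eq[where F = F])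
      (use f1 f2 integral_max_diff_bounds in \<open>auto simp: G_diff cdf\<close>)
  have neg: "integrable \<mu> (\<lambda>x. max (s - x) 0) \<and> (\<integral>x. max (s - x) 0 \<partial>\<mu>) = f s" for s
  proof -
    \<comment> \<open>Truncation at \<open>- real n\<close> gives the integrals
      \<open>f s - f (- real n)\<close>, which tend to \<open>f s\<close>; monotone convergence then
      yields integrability and the value together.\<close>
    let ?u = "\<lambda>n x. max (s - x) 0 - max (- real n - x) 0"
    have "mono (\<lambda>n. ?u n x)" for x by (auto simp: mono_def max_def)
    moreover have "(\<lambda>n. ?u n x) \<longlonglongrightarrow> max (s - x) 0" for x
    proof (rule tendsto_eventually)
      show "\<forall>\<^sub>F n in sequentially. ?u n x = max (s - x) 0"
        using filterlim_real_sequentially[THEN filterlim_at_top[THEN iffD1], rule_format, of "- x"]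
        by eventually_elim auto
    qed
    moreover have "(\<lambda>n. \<integral>x. ?u n x \<partial>\<mu>) \<longlonglongrightarrow> f s"
    proof -
      have "(\<lambda>n. f (- real n)) \<longlonglongrightarrow> 0"
        by (rule filterlim_compose[OF bot]) real_asymp
      then show ?thesis unfolding G by (auto intro!: tendsto_eq_intros)
    qed
    ultimately show ?thesis
      using integrable_monotone_convergence[of \<mu> ?u "\<lambda>x. max (s - x) 0" "f s"]
        integral_monotone_convergence[of \<mu> ?u "\<lambda>x. max (s - x) 0" "f s"] integrable_max_diff
      by auto
  qed
  have pos: "integrable \<mu> (\<lambda>x. max x 0)"
  proof -
    \<comment> \<open>\<open>?u n x\<close> equals \<open>min (real n) (max x 0)\<close>. Its
      integral is \<open>real n - (f (real n) - f 0)\<close>, at most \<open>B + f 0\<close> by the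
      lower growth bound, so the positive part has a finite mean.\<close>
    let ?u = "\<lambda>n x. real n - (max (real n - x) 0 - max (0 - x) 0)"
    have int: "integrable \<mu> (?u n)" for n
      by (rule Bochner_Integration.integrable_diff[OF _ integrable_max_diff]) simp
    have eq: "(\<integral>x. ?u n x \<partial>\<mu>) = real n - (f (real n) - f 0)" for n
      using Bochner_Integration.integral_diff[OF integrable_const integrable_max_diff, of "real n" "real n" 0]
        prob_space by (simp only: G space_eq_univ lebesgue_integral_const scaleR_one)
    have mono_u: "mono (\<lambda>n. ?u n x)" for x by (auto simp: mono_def max_def)
    have "incseq (\<lambda>n. \<integral>x. ?u n x \<partial>\<mu>)"
      unfolding incseq_def using mono_u int by (auto intro!: integral_mono simp: mono_def)
    moreover have "\<forall>n. (\<integral>x. ?u n x \<partial>\<mu>) \<le> B + f 0"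
      unfolding eq using ge by (auto simp: algebra_simps)
    ultimately obtain l where l: "(\<lambda>n. \<integral>x. ?u n x \<partial>\<mu>) \<longlonglongrightarrow> l"
      using incseq_convergent by blast
    have "(\<lambda>n. ?u n x) \<longlonglongrightarrow> max x 0" for x
    proof (rule tendsto_eventually)
      show "\<forall>\<^sub>F n in sequentially. ?u n x = max x 0"
        using filterlim_real_sequentially[THEN filterlim_at_top[THEN iffD1], rule_format, of x]
        by eventually_elim auto
    qed
    then show ?thesis
      by (intro integrable_monotone_convergence[OF int _ _ l]) (use mono_u in auto)
  qed
  have "integrable \<mu> (\<lambda>x. max (0 - x) 0 + max x 0)"
    using neg[of 0] pos by (intro Bochner_Integration.integrable_add) auto
  also have "(\<lambda>x. max (0 - x) 0 + max x 0) = (\<lambda>x::real. \<bar>x\<bar>)" by (auto simp: max_def)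
  finally have "\<mu> \<in> P1" using rd by (simp add: P1_def)
  moreover have "lower_pot \<mu> = f" using neg by (auto simp: lower_pot_def)
  ultimately show ?thesis by blast
qed

section \<open>Convergence of potentials and the Wasserstein metric\<close>

text \<open>Slopes of the potentials converge. A slope over \<open>[t, x]\<close> is at most the
  distribution function at \<open>x\<close> and at least the one at \<open>t\<close>, and a slope
  over \<open>[x, t]\<close> bounds it from the other side; at a continuity point of
  \<open>cdf \<sigma>\<close>, taking \<open>t\<close> close to \<open>x\<close> squeezes the
  limit.\<close>

lemma weak_conv_m_lower_pot:
  assumes m: "\<And>n. m n \<in> P1" and "\<sigma> \<in> P1"
    and lim: "\<And>s. (\<lambda>n. lower_pot (m n) s) \<longlonglongrightarrow> lower_pot \<sigma> s"
  shows "weak_conv_m m \<sigma>"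
  unfolding weak_conv_m_def weak_conv_def
proof (intro allI impI)
  fix x assume cont: "isCont (cdf \<sigma>) x"
  show "(\<lambda>n. cdf (m n) x) \<longlonglongrightarrow> cdf \<sigma> x"
  proof (rule order_tendstoI)
    fix y assume "y < cdf \<sigma> x"
    with cont have "\<forall>\<^sub>F t in at_left x. y < cdf \<sigma> t"
      by (auto simp: continuous_at_imp_continuous_at_within continuous_within filterlim_at_split isCont_def intro: order_tendstoD)
    then obtain t where t: "t < x" "y < cdf \<sigma> t"
      by (auto simp: eventually_at_left[of "x - 1" x]) (metis dense)
    have conv: "(\<lambda>n. (lower_pot (m n) x - lower_pot (m n) t) / (x - t)) \<longlonglongrightarrow> (lower_pot \<sigma> x - lower_pot \<sigma> t) / (x - t)"
      by (intro tendsto_intros lim) (use t in auto)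
    have "cdf \<sigma> t \<le> (lower_pot \<sigma> x - lower_pot \<sigma> t) / (x - t)"
      using lower_pot_diff_bounds(1)[OF assms(2), of t x] t by (simp add: field_simps)
    with t(2) have "\<forall>\<^sub>F n in sequentially. y < (lower_pot (m n) x - lower_pot (m n) t) / (x - t)"
      by (intro order_tendstoD(1)[OF conv]) simp
    then show "\<forall>\<^sub>F n in sequentially. y < cdf (m n) x"
    proof eventually_elim
      case (elim n)
      have "(lower_pot (m n) x - lower_pot (m n) t) / (x - t) \<le> cdf (m n) x"
        using lower_pot_diff_bounds(2)[OF m, of t x n] t by (simp add: field_simps)
      with elim show ?case by simp
    qed
  next
    fix y assume "cdf \<sigma> x < y"
    with cont have "\<forall>\<^sub>F t in at_right x. cdf \<sigma> t < y"
      by (auto simp: filterlim_at_split isCont_def intro: order_tendstoD)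
    then obtain t where t: "x < t" "cdf \<sigma> t < y"
      by (auto simp: eventually_at_right[of x "x + 1"]) (metis dense)
    have conv: "(\<lambda>n. (lower_pot (m n) t - lower_pot (m n) x) / (t - x)) \<longlonglongrightarrow> (lower_pot \<sigma> t - lower_pot \<sigma> x) / (t - x)"
      by (intro tendsto_intros lim) (use t in auto)
    have "(lower_pot \<sigma> t - lower_pot \<sigma> x) / (t - x) \<le> cdf \<sigma> t"
      using lower_pot_diff_bounds(2)[OF assms(2), of x t] t by (simp add: field_simps)
    with t(2) have "\<forall>\<^sub>F n in sequentially. (lower_pot (m n) t - lower_pot (m n) x) / (t - x) < y"
      by (intro order_tendstoD(2)[OF conv]) simp
    then show "\<forall>\<^sub>F n in sequentially. cdf (m n) x < y"
    proof eventually_elim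
      case (elim n)
      have "cdf (m n) x \<le> (lower_pot (m n) t - lower_pot (m n) x) / (t - x)"
        using lower_pot_diff_bounds(1)[OF m, of x t n] t by (simp add: field_simps)
      with elim show ?case by simp
    qed
  qed
qed

text \<open>The joint law of \<open>X\<close> and \<open>Y\<close> is a coupling of their
  distributions, and the infimum is at most its cost.\<close>

lemma W1_le:
  assumes "prob_space \<Omega>" "X \<in> borel_measurable \<Omega>" "Y \<in> borel_measurable \<Omega>"
  shows "W1 (distr \<Omega> borel X) (distr \<Omega> borel Y) \<le> (\<integral>\<^sup>+\<omega>. ennreal \<bar>X \<omega> - Y \<omega>\<bar> \<partial>\<Omega>)"
proof -
  interpret prob_space \<Omega> by (rule assms)
  note [measurable] = assms(2,3)
  let ?\<pi> = "distr \<Omega> (borel \<Otimes>\<^sub>M borel) (\<lambda>\<omega>. (X \<omega>, Y \<omega>))"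
  have "?\<pi> \<in> couplings (distr \<Omega> borel X) (distr \<Omega> borel Y)"
    unfolding couplings_def by (auto simp: distr_distr o_def intro!: prob_space_distr)
  then have "W1 (distr \<Omega> borel X) (distr \<Omega> borel Y) \<le> (\<integral>\<^sup>+(x, y). ennreal \<bar>x - y\<bar> \<partial>?\<pi>)"
    unfolding W1_def by (rule INF_lower)
  also have "\<dots> = (\<integral>\<^sup>+\<omega>. ennreal \<bar>X \<omega> - Y \<omega>\<bar> \<partial>\<Omega>)"
    by (subst nn_integral_distr) auto
  finally show ?thesis .
qed

lemma integral_abs_eq:
  assumes "\<mu> \<in> P1"
  shows "(\<integral>x. \<bar>x\<bar> \<partial>\<mu>) = lower_pot \<mu> 0 + upper_part \<mu> 0"
proof -
  have "(\<integral>x. \<bar>x\<bar> \<partial>\<mu>) = (\<integral>x. max (0 - x) 0 + max (x - 0) 0 \<partial>\<mu>)"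
    by (rule Bochner_Integration.integral_cong) auto
  then show ?thesis
    unfolding lower_pot_def upper_part_def using P1_D[OF assms] by simp
qed

text \<open>Pointwise convergence of one potential gives weak convergence, that of both gives convergence of
  the first absolute moments; along a Skorohod coupling, Scheffe's lemma turns this into convergence in mean.\<close>

lemma W1_tendsto_potentials:
  assumes m: "\<And>n. m n \<in> P1" and "\<sigma> \<in> P1"
    and lower: "\<And>s. (\<lambda>n. lower_pot (m n) s) \<longlonglongrightarrow> lower_pot \<sigma> s"
    and upper: "(\<lambda>n. upper_part (m n) 0) \<longlonglongrightarrow> upper_part \<sigma> 0"
  shows "W1_tendsto m \<sigma>"
proof -
  obtain \<Omega> :: "real measure" and X Y where \<Omega>: "prob_space \<Omega>"
    and X: "\<And>n. X n \<in> borel_measurable \<Omega>" "\<And>n. distr \<Omega> borel (X n) = m n"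
    and Y: "Y \<in> borel_measurable \<Omega>" "distr \<Omega> borel Y = \<sigma>"
    and lim: "\<And>\<omega>. \<omega> \<in> space \<Omega> \<Longrightarrow> (\<lambda>n. X n \<omega>) \<longlonglongrightarrow> Y \<omega>"
    using Skorohod[OF P1_D(1)[OF m] P1_D(1)[OF assms(2)] weak_conv_m_lower_pot[OF m assms(2) lower]]
    unfolding measurable_lborel1 by metis
  have int: "integrable \<Omega> (X n)" "(\<integral>\<omega>. \<bar>X n \<omega>\<bar> \<partial>\<Omega>) = lower_pot (m n) 0 + upper_part (m n) 0" for n
    using P1_D(4)[OF m, of n] X(1)[of n] integral_abs_eq[OF m, of n] unfolding X(2)[of n, symmetric]
    by (auto simp: integrable_distr_eq integral_distr)
  have intY: "integrable \<Omega> Y" "(\<integral>\<omega>. \<bar>Y \<omega>\<bar> \<partial>\<Omega>) = lower_pot \<sigma> 0 + upper_part \<sigma> 0"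
    using P1_D(4)[OF assms(2)] Y(1) integral_abs_eq[OF assms(2)] unfolding Y(2)[symmetric]
    by (auto simp: integrable_distr_eq integral_distr)
  have nn: "(\<integral>\<^sup>+\<omega>. norm (Z \<omega>) \<partial>\<Omega>) = ennreal (\<integral>\<omega>. \<bar>Z \<omega>\<bar> \<partial>\<Omega>)" if "integrable \<Omega> Z" for Z :: "real \<Rightarrow> real"
    using that by (subst nn_integral_eq_integral) auto
  have "(\<lambda>n. \<integral>\<^sup>+\<omega>. norm (X n \<omega>) \<partial>\<Omega>) \<longlonglongrightarrow> (\<integral>\<^sup>+\<omega>. norm (Y \<omega>) \<partial>\<Omega>)"
    unfolding nn[OF int(1)] nn[OF intY(1)] unfolding int(2) intY(2)
    by (intro tendsto_ennrealI tendsto_add lower upper)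
  then have "limsup (\<lambda>n. \<integral>\<^sup>+\<omega>. norm (X n \<omega>) \<partial>\<Omega>) \<le> (\<integral>\<^sup>+\<omega>. norm (Y \<omega>) \<partial>\<Omega>)"
    by (simp add: lim_imp_Limsup)
  then have mean: "(\<lambda>n. \<integral>\<^sup>+\<omega>. norm (X n \<omega> - Y \<omega>) \<partial>\<Omega>) \<longlonglongrightarrow> 0"
    by (intro Scheffe_lemma1 int intY) (auto simp: lim)
  show ?thesis
    unfolding W1_tendsto_def
    by (rule tendsto_sandwich[OF _ _ tendsto_const mean])
      (use W1_le[OF \<Omega> X(1) Y(1)] in \<open>auto simp: X(2) Y(2)\<close>)
qed

text \<open>By \<open>upper_part_eq\<close> it remains to show that the means converge. Domination
  by \<open>\<beta>\<close> makes all upper parts small at one common point \<open>t\<close>, where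
  the means are determined by the convergent lower potentials up to a small error.\<close>

lemma upper_part_tendsto:
  assumes m: "\<And>n. m n \<in> P1" and \<sigma>: "\<sigma> \<in> P1" and \<beta>: "\<beta> \<in> P1"
    and lower: "\<And>s. (\<lambda>n. lower_pot (m n) s) \<longlonglongrightarrow> lower_pot \<sigma> s"
    and le: "\<And>n s. upper_part (m n) s \<le> upper_part \<beta> s"
  shows "(\<lambda>n. upper_part (m n) s) \<longlonglongrightarrow> upper_part \<sigma> s"
proof -
  let ?e = "\<lambda>\<mu>. \<integral>x. x \<partial>\<mu>"
  have "(\<lambda>n. ?e (m n)) \<longlonglongrightarrow> ?e \<sigma>"
  proof (rule tendstoI)
    fix \<epsilon> :: real assume "0 < \<epsilon>"
    then have "0 < \<epsilon> / 2" by simp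
    then have "\<forall>\<^sub>F t in at_top. upper_part \<beta> t < \<epsilon> / 2 \<and> upper_part \<sigma> t < \<epsilon> / 2"
      by (intro eventually_conj order_tendstoD(2)[OF upper_part_at_top] \<beta> \<sigma>)
    then obtain t where t: "upper_part \<beta> t < \<epsilon> / 2" "upper_part \<sigma> t < \<epsilon> / 2"
      by (metis (no_types, lifting) eventually_at_top_linorder order_refl)
    have "\<forall>\<^sub>F n in sequentially. dist (lower_pot (m n) t) (lower_pot \<sigma> t) < \<epsilon> / 2"
      using lower \<open>0 < \<epsilon> / 2\<close> by (rule tendstoD)
    then show "\<forall>\<^sub>F n in sequentially. dist (?e (m n)) (?e \<sigma>) < \<epsilon>"
    proof eventually_elim
      case (elim n)
      \<comment> \<open>The mean is \<open>upper_part - lower_pot + t\<close>. Both upper parts lie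
        in \<open>[0, \<epsilon> / 2)\<close>, so they differ by less than
        \<open>\<epsilon> / 2\<close>; the lower potentials account for the other half.\<close>
      then show ?case
        using t le[of n t] upper_part_eq[OF m, of n t] upper_part_eq[OF \<sigma>, of t]
          upper_part_nonneg[of "m n" t] upper_part_nonneg[of \<sigma> t]
        unfolding dist_real_def by linarith
    qed
  qed
  then show ?thesis
    unfolding upper_part_eq[OF m] upper_part_eq[OF \<sigma>] by (intro tendsto_intros lower)
qed

text \<open>Reflection reduces this to the previous lemma; the dominating measure now controls the
  left tails.\<close>

lemma lower_pot_tendsto:
  assumes m: "\<And>n. m n \<in> P1" and \<sigma>: "\<sigma> \<in> P1" and \<alpha>: "\<alpha> \<in> P1"
    and upper: "\<And>s. (\<lambda>n. upper_part (m n) s) \<longlonglongrightarrow> upper_part \<sigma> s"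
    and le: "\<And>n s. lower_pot (m n) s \<le> lower_pot \<alpha> s"
  shows "(\<lambda>n. lower_pot (m n) s) \<longlonglongrightarrow> lower_pot \<sigma> s"
  using upper_part_tendsto[of "\<lambda>n. reflect (m n)" "reflect \<sigma>" "reflect \<alpha>" "- s"] upper le
  by (simp add: reflect_P1 m \<sigma> \<alpha>)

section \<open>Lattices ordered by potentials\<close>

text \<open>For each pair of rationals \<open>q\<close>, \<open>r\<close> one member of
  \<open>A\<close> exceeding \<open>r\<close> at \<open>q\<close> is kept, if there is one. A bound
  \<open>g\<close> of the kept members cannot lie below any \<open>p a\<close> at a rational point,
  as a rational between the two values would select a kept member above \<open>g\<close>; continuity
  extends this to all points.\<close>

lemma countable_dominating:
  fixes p :: "'a \<Rightarrow> real \<Rightarrow> real"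
  assumes cont: "\<And>a. a \<in> A \<Longrightarrow> continuous_on UNIV (p a)"
  shows "\<exists>C\<subseteq>A. countable C \<and>
    (\<forall>g. continuous_on UNIV g \<longrightarrow> (\<forall>c\<in>C. \<forall>s. p c s \<le> g s) \<longrightarrow> (\<forall>a\<in>A. \<forall>s. p a s \<le> g s))"
proof -
  define ch where "ch q r = (SOME a. a \<in> A \<and> r < p a q)" for q r
  have ch: "ch q r \<in> A \<and> r < p (ch q r) q" if "a \<in> A" "r < p a q" for a q r
    unfolding ch_def by (rule someI[where x = a]) (use that in simp)
  \<comment> \<open>Intersecting with \<open>A\<close> discards the arbitrary values of
    \<open>ch\<close> at pairs where no member exceeds \<open>r\<close>.\<close>
  define C where "C = (\<lambda>(q, r). ch q r) ` (\<rat> \<times> \<rat>) \<inter> A"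
  have "p a s \<le> g s"
    if g: "continuous_on UNIV g" "\<forall>c\<in>C. \<forall>s. p c s \<le> g s" and a: "a \<in> A" for g a s
  proof -
    have *: "p a q \<le> g q" if "q \<in> \<rat>" for q
    proof (rule ccontr)
      assume "\<not> p a q \<le> g q"
      then obtain r where r: "r \<in> \<rat>" "g q < r" "r < p a q"
        using Rats_dense_in_real[of "g q" "p a q"] by auto
      have "ch q r \<in> C" using r ch[OF a r(3)] that by (auto simp: C_def)
      then show False using g(2) ch[OF a r(3)] r(2) by (metis order_less_le_trans order_less_asym)
    qed
    have "s \<in> closure \<rat>" by (simp add: Rats_closure_real)
    moreover have "closed {t. p a t \<le> g t}"
      by (intro closed_Collect_le cont a g)
    ultimately show ?thesis
      using closure_minimal[of \<rat> "{t. p a t \<le> g t}"] * by auto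
  qed
  moreover have "countable C" unfolding C_def by (auto intro!: countable_Int1 simp: countable_rat)
  ultimately show ?thesis by (intro exI[of _ C]) (auto simp: C_def)
qed

lemma inv_gorder_dedekind_super_complete:
  "dedekind_super_complete L \<Longrightarrow> dedekind_super_complete (inv_gorder L)"
  unfolding dedekind_super_complete_def bdd_above_in_def bdd_below_in_def
    Upper_dual Lower_dual least_dual greatest_dual
  by (auto intro: lattice.dual_lattice)

text \<open>Enumerate \<open>C\<close> by a sequence \<open>c\<close>. Directedness supplies, step
  by step, a member of \<open>M\<close> above the join of the current term and the next
  \<open>c\<close>.\<close>

lemma directed_up_chain:
  fixes L :: "'a gorder" (structure)
  assumes "M \<subseteq> carrier L" "directed_up L M" "C \<subseteq> M" "countable C" "C \<noteq> {}"
    and "lattice L"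
  shows "\<exists>m :: nat \<Rightarrow> 'a. range m \<subseteq> M \<and> monotone (\<le>) (le L) m \<and> (\<forall>c\<in>C. \<exists>n. c \<sqsubseteq> m n)"
proof -
  interpret lattice L by fact
  obtain c :: "nat \<Rightarrow> 'a" where c: "range c = C"
    using assms(4,5) by (metis range_from_nat_into)
  have "\<exists>m. \<forall>n. (m n \<in> M \<and> c n \<sqsubseteq> m n) \<and> m n \<sqsubseteq> m (Suc n)"
  proof (rule dependent_nat_choice)
    show "\<exists>x. x \<in> M \<and> c 0 \<sqsubseteq> x"
      using c assms by (intro exI[of _ "c 0"] conjI le_refl) blast+
  next
    fix x n assume x: "x \<in> M \<and> c n \<sqsubseteq> x"
    have cM: "c (Suc n) \<in> M" using c assms by auto
    obtain z where z: "z \<in> M" "x \<squnion> c (Suc n) \<sqsubseteq> z"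
      using assms(2) x cM unfolding directed_up_def by blast
    have carr: "x \<in> carrier L" "c (Suc n) \<in> carrier L" "z \<in> carrier L"
      using assms(1) x cM z by auto
    then show "\<exists>y. (y \<in> M \<and> c (Suc n) \<sqsubseteq> y) \<and> x \<sqsubseteq> y"
      using z join_left[OF carr(1,2)] join_right[OF carr(1,2)] by (meson join_closed le_trans)
  qed
  then obtain m where m: "\<And>n. m n \<in> M" "\<And>n. c n \<sqsubseteq> m n" "\<And>n. m n \<sqsubseteq> m (Suc n)" by auto
  have "m i \<sqsubseteq> m j" if "i \<le> j" for i j
    using that
  proof (induction rule: dec_induct)
    case base
    show ?case using m(1) assms(1) by blast
  next
    case (step k)
    then show ?case using m(1,3) assms(1) by (meson le_trans subsetD)
  qed
  then show ?thesis
    using m(1,2) c by (intro exI[of _ m] conjI monotoneI) (blast+)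
qed

section \<open>Lattice structure and super completeness of an abstract potential order\<close>

definition potential_order :: "(real measure \<Rightarrow> real \<Rightarrow> real) \<Rightarrow> real measure gorder" where
  "potential_order p = \<lparr>carrier = P1, eq = (=), le = (\<lambda>\<mu> \<nu>. \<forall>s. p \<mu> s \<le> p \<nu> s)\<rparr>"

text \<open>This collects what the two potentials share, so that completeness and the sequence
  arguments are proved once. In \<open>between\<close> the two enclosing potentials supply the
  behaviour at infinity, leaving convexity as the condition to be checked.\<close>

locale potential =
  fixes p :: "real measure \<Rightarrow> real \<Rightarrow> real"
  assumes inj: "\<lbrakk>\<mu> \<in> P1; \<nu> \<in> P1; p \<mu> = p \<nu>\<rbrakk> \<Longrightarrow> \<mu> = \<nu>"
    and convex: "\<mu> \<in> P1 \<Longrightarrow> convex_on UNIV (p \<mu>)"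
    and between: "\<lbrakk>\<mu> \<in> P1; \<nu> \<in> P1; convex_on UNIV f; \<And>s. p \<mu> s \<le> f s; \<And>s. f s \<le> p \<nu> s\<rbrakk>
      \<Longrightarrow> \<exists>\<sigma>\<in>P1. p \<sigma> = f"
    and upper: "\<lbrakk>\<mu> \<in> P1; \<nu> \<in> P1\<rbrakk> \<Longrightarrow> \<exists>\<eta>\<in>P1. \<forall>s. p \<mu> s \<le> p \<eta> s \<and> p \<nu> s \<le> p \<eta> s"
    and lower: "\<lbrakk>\<mu> \<in> P1; \<nu> \<in> P1\<rbrakk> \<Longrightarrow> \<exists>\<eta>\<in>P1. \<forall>s. p \<eta> s \<le> p \<mu> s \<and> p \<eta> s \<le> p \<nu> s"
begin

abbreviation "L \<equiv> potential_order p"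

lemma order_simps:
  "carrier L = P1" "eq L = (=)" "le L \<mu> \<nu> \<longleftrightarrow> (\<forall>s. p \<mu> s \<le> p \<nu> s)"
  by (simp_all add: potential_order_def)

lemma Upper_iff: "A \<subseteq> P1 \<Longrightarrow> \<nu> \<in> Upper L A \<longleftrightarrow> \<nu> \<in> P1 \<and> (\<forall>\<mu>\<in>A. \<forall>s. p \<mu> s \<le> p \<nu> s)"
  and Lower_iff: "A \<subseteq> P1 \<Longrightarrow> \<nu> \<in> Lower L A \<longleftrightarrow> \<nu> \<in> P1 \<and> (\<forall>\<mu>\<in>A. \<forall>s. p \<nu> s \<le> p \<mu> s)"
  by (auto simp: Upper_def Lower_def order_simps)

lemma least_iff: "least L \<sigma> X \<longleftrightarrow> X \<subseteq> P1 \<and> \<sigma> \<in> X \<and> (\<forall>\<nu>\<in>X. \<forall>s. p \<sigma> s \<le> p \<nu> s)"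
  and greatest_iff: "greatest L \<sigma> X \<longleftrightarrow> X \<subseteq> P1 \<and> \<sigma> \<in> X \<and> (\<forall>\<nu>\<in>X. \<forall>s. p \<nu> s \<le> p \<sigma> s)"
  by (auto simp: least_def greatest_def order_simps)

lemma continuous: "\<mu> \<in> P1 \<Longrightarrow> continuous_on UNIV (p \<mu>)"
  using convex by (intro convex_on_continuous) auto

sublocale partial_order L
proof unfold_locales
  fix \<mu> \<nu> assume "le L \<mu> \<nu>" "le L \<nu> \<mu>" "\<mu> \<in> carrier L" "\<nu> \<in> carrier L"
  then show "eq L \<mu> \<nu>"
    using inj[of \<mu> \<nu>] by (auto simp: order_simps fun_eq_iff intro: antisym)
qed (auto simp: order_simps intro: order_trans)

text \<open>The pointwise supremum is convex and lies between a member of \<open>A\<close> and an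
  upper bound, hence is itself a potential.\<close>

lemma ex_least_Upper:
  assumes A: "A \<subseteq> P1" "A \<noteq> {}" and bdd: "bdd_above_in L A"
  shows "\<exists>\<sigma>. least L \<sigma> (Upper L A)"
proof -
  obtain \<eta> where \<eta>: "\<eta> \<in> P1" "\<And>\<mu> s. \<mu> \<in> A \<Longrightarrow> p \<mu> s \<le> p \<eta> s"
    using bdd Upper_iff[OF A(1)] unfolding bdd_above_in_def by blast
  define f where "f s = (SUP \<mu>\<in>A. p \<mu> s)" for s
  have bdd: "bdd_above ((\<lambda>\<mu>. p \<mu> s) ` A)" for s
    using \<eta> by (auto intro!: bdd_aboveI2)
  have up: "p \<mu> s \<le> f s" if "\<mu> \<in> A" for \<mu> s
    unfolding f_def using that bdd by (rule cSUP_upper)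
  have low: "f s \<le> c" if "\<And>\<mu>. \<mu> \<in> A \<Longrightarrow> p \<mu> s \<le> c" for s c
    unfolding f_def using A(2) that by (rule cSUP_least)
  have "convex_on UNIV f"
  proof (rule convex_onI)
    fix t x y :: real assume t: "0 < t" "t < 1"
    show "f ((1 - t) *\<^sub>R x + t *\<^sub>R y) \<le> (1 - t) * f x + t * f y"
    proof (rule low)
      fix \<mu> assume \<mu>: "\<mu> \<in> A"
      have "p \<mu> ((1 - t) *\<^sub>R x + t *\<^sub>R y) \<le> (1 - t) * p \<mu> x + t * p \<mu> y"
        using convex_onD[OF convex, of \<mu> t x y] \<mu> A t by auto
      also have "\<dots> \<le> (1 - t) * f x + t * f y"
        using t up[OF \<mu>] by (intro add_mono mult_left_mono) auto
      finally show "p \<mu> ((1 - t) *\<^sub>R x + t *\<^sub>R y) \<le> (1 - t) * f x + t * f y" .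
    qed
  qed simp
  moreover obtain \<mu> where "\<mu> \<in> A" using A(2) by auto
  ultimately obtain \<sigma> where "\<sigma> \<in> P1" "p \<sigma> = f"
    using between[of \<mu> \<eta> f] A \<eta> up low by blast
  then show ?thesis
    using A up low by (intro exI[of _ \<sigma>]) (auto simp: least_iff Upper_iff)
qed

text \<open>A pointwise infimum of convex functions need not be convex. The infimum is instead the
  supremum of all lower bounds, a set bounded above by every member of \<open>A\<close>.\<close>

lemma ex_greatest_Lower:
  assumes A: "A \<subseteq> P1" "A \<noteq> {}" and bdd: "bdd_below_in L A"
  shows "\<exists>\<sigma>. greatest L \<sigma> (Lower L A)"
proof -
  have sub: "Lower L A \<subseteq> P1" using Lower_closed[of L A] by (simp add: order_simps)
  have up: "A \<subseteq> Upper L (Lower L A)"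
    using A sub by (auto simp: Upper_iff Lower_iff)
  then obtain \<sigma> where \<sigma>: "least L \<sigma> (Upper L (Lower L A))"
    using ex_least_Upper[OF sub] A bdd by (auto simp: bdd_above_in_def bdd_below_in_def)
  have "\<sigma> \<in> Upper L (Lower L A)" "\<forall>\<mu>\<in>A. \<forall>s. p \<sigma> s \<le> p \<mu> s"
    using \<sigma> up unfolding least_iff by blast+
  then have "greatest L \<sigma> (Lower L A)"
    using A(1) sub by (auto simp: greatest_iff Upper_iff Lower_iff)
  then show ?thesis ..
qed

lemma countable_Upper:
  assumes "A \<subseteq> P1"
  obtains C where "C \<subseteq> A" "countable C" "Upper L C = Upper L A"
proof -
  obtain C where C: "C \<subseteq> A" "countable C"
    and dom: "\<forall>g. continuous_on UNIV g \<longrightarrow> (\<forall>c\<in>C. \<forall>s. p c s \<le> g s) \<longrightarrow> (\<forall>a\<in>A. \<forall>s. p a s \<le> g s)"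
    using countable_dominating[of A p] continuous assms by blast
  have "C \<subseteq> P1" using C(1) assms by blast
  then have "Upper L C = Upper L A"
    using C(1) dom continuous unfolding set_eq_iff Upper_iff[OF assms] Upper_iff[OF \<open>C \<subseteq> P1\<close>]
    by blast
  with C that show thesis by blast
qed

text \<open>\<open>countable_dominating\<close> asks only for continuity, so it applies to the
  negated potentials although these are concave.\<close>

lemma countable_Lower:
  assumes "A \<subseteq> P1"
  obtains C where "C \<subseteq> A" "countable C" "Lower L C = Lower L A"
proof -
  obtain C where C: "C \<subseteq> A" "countable C"
    and dom: "\<forall>g. continuous_on UNIV g \<longrightarrow> (\<forall>c\<in>C. \<forall>s. - p c s \<le> g s) \<longrightarrow> (\<forall>a\<in>A. \<forall>s. - p a s \<le> g s)"
    using countable_dominating[of A "\<lambda>\<mu> s. - p \<mu> s", OF continuous_on_minus[OF continuous]] assms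
    by blast
  have "C \<subseteq> P1" using C(1) assms by blast
  then have "\<nu> \<in> Lower L A" if "\<nu> \<in> Lower L C" for \<nu>
    using that assms dom[rule_format, OF continuous_on_minus[OF continuous], of \<nu>]
    by (auto simp: Lower_iff)
  moreover have "Lower L A \<subseteq> Lower L C"
    using C(1) by (auto simp: Lower_def)
  ultimately have "Lower L C = Lower L A" by blast
  with C that show thesis by blast
qed

sublocale lattice L
proof
  fix \<mu> \<nu> assume "\<mu> \<in> carrier L" "\<nu> \<in> carrier L"
  then have P: "\<mu> \<in> P1" "\<nu> \<in> P1" by (simp_all add: order_simps)
  \<comment> \<open>Since bounded nonempty sets have extrema, a pair only needs some bound on each
    side.\<close>
  have "bdd_above_in L {\<mu>, \<nu>}" "bdd_below_in L {\<mu>, \<nu>}"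
    using upper[OF P] lower[OF P] P by (auto simp: bdd_above_in_def bdd_below_in_def ex_in_conv[symmetric] Upper_iff Lower_iff)
  then show "\<exists>\<sigma>. least L \<sigma> (Upper L {\<mu>, \<nu>})" "\<exists>\<sigma>. greatest L \<sigma> (Lower L {\<mu>, \<nu>})"
    using P by (auto intro!: ex_least_Upper ex_greatest_Lower)
qed

lemma dedekind_super_complete: "dedekind_super_complete L"
  unfolding dedekind_super_complete_def
proof (intro conjI allI impI; (elim conjE)?)
  show "lattice L" by (rule lattice_axioms)
next
  fix A assume A: "A \<subseteq> carrier L" "A \<noteq> {}" "bdd_above_in L A"
  then obtain \<sigma> where "least L \<sigma> (Upper L A)"
    using ex_least_Upper by (auto simp: order_simps)
  moreover obtain C where "C \<subseteq> A" "countable C" "Upper L C = Upper L A"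
    using countable_Upper A by (auto simp: order_simps)
  ultimately show "\<exists>s. least L s (Upper L A) \<and> (\<exists>C\<subseteq>A. countable C \<and> least L s (Upper L C))"
    by metis
next
  fix A assume A: "A \<subseteq> carrier L" "A \<noteq> {}" "bdd_below_in L A"
  then obtain \<sigma> where "greatest L \<sigma> (Lower L A)"
    using ex_greatest_Lower by (auto simp: order_simps)
  moreover obtain C where "C \<subseteq> A" "countable C" "Lower L C = Lower L A"
    using countable_Lower A by (auto simp: order_simps)
  ultimately show "\<exists>s. greatest L s (Lower L A) \<and> (\<exists>C\<subseteq>A. countable C \<and> greatest L s (Lower L C))"
    by metis
qed

section \<open>Monotone sequences and directed sets\<close>

lemma potential_of_limit:
  assumes m: "\<And>n. m n \<in> P1" and "\<mu> \<in> P1" "\<nu> \<in> P1"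
    and bounds: "\<And>n s. p \<mu> s \<le> p (m n) s" "\<And>n s. p (m n) s \<le> p \<nu> s"
    and lim: "\<And>s. (\<lambda>n. p (m n) s) \<longlonglongrightarrow> f s"
  shows "\<exists>\<sigma>\<in>P1. p \<sigma> = f"
proof (rule between[OF assms(2,3)])
  \<comment> \<open>The convexity inequality is closed under pointwise limits.\<close>
  show "convex_on UNIV f"
  proof (rule convex_onI)
    fix t x y :: real assume t: "0 < t" "t < 1"
    show "f ((1 - t) *\<^sub>R x + t *\<^sub>R y) \<le> (1 - t) * f x + t * f y"
    proof (rule LIMSEQ_le[OF lim])
      show "(\<lambda>n. (1 - t) * p (m n) x + t * p (m n) y) \<longlonglongrightarrow> (1 - t) * f x + t * f y"
        by (intro tendsto_intros lim)
      show "\<exists>N. \<forall>n\<ge>N. p (m n) ((1 - t) *\<^sub>R x + t *\<^sub>R y) \<le> (1 - t) * p (m n) x + t * p (m n) y"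
        using convex_onD[OF convex[OF m], of t x y] t by auto
    qed
  qed simp
  show "p \<mu> s \<le> f s" for s using bounds(1) by (intro LIMSEQ_le_const[OF lim]) blast
  show "f s \<le> p \<nu> s" for s using bounds(2) by (intro LIMSEQ_le_const2[OF lim]) blast
qed

text \<open>The pointwise limit is the potential of some \<open>\<tau>\<close>, which is an upper
  bound of the sequence and so lies above \<open>\<sigma>\<close>; being a limit of values below
  \<open>p \<sigma>\<close>, it also lies below.\<close>

lemma potential_tendsto_sup:
  assumes m: "range m \<subseteq> P1" and mono: "monotone (\<le>) (le L) m" and "least L \<sigma> (Upper L (range m))"
  shows "(\<lambda>n. p (m n) s) \<longlonglongrightarrow> p \<sigma> s"
proof -
  have \<sigma>: "\<sigma> \<in> P1" "\<And>n s. p (m n) s \<le> p \<sigma> s" "\<And>\<nu> s. \<lbrakk>\<nu> \<in> P1; \<And>n s. p (m n) s \<le> p \<nu> s\<rbrakk> \<Longrightarrow> p \<sigma> s \<le> p \<nu> s"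
    using assms by (auto simp: least_iff Upper_iff)
  have inc: "incseq (\<lambda>n. p (m n) s)" for s
    using mono by (auto simp: incseq_def monotone_def order_simps)
  have "\<exists>l. (\<lambda>n. p (m n) s) \<longlonglongrightarrow> l" for s
    using incseq_convergent[OF inc, of s "p \<sigma> s"] \<sigma>(2) by metis
  then obtain f where f: "\<And>s. (\<lambda>n. p (m n) s) \<longlonglongrightarrow> f s" by metis
  have "p (m 0) s \<le> p (m n) s" for n s using inc[of s] by (auto simp: incseq_def)
  then obtain \<tau> where \<tau>: "\<tau> \<in> P1" "p \<tau> = f"
    using potential_of_limit[of m "m 0" \<sigma> f] m \<sigma> f by blast
  have "p (m n) s \<le> f s" for n s by (rule incseq_le[OF inc f])
  then have "p \<sigma> s \<le> f s" using \<sigma>(3)[OF \<tau>(1)] \<tau>(2) by simp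
  moreover have "f s \<le> p \<sigma> s" using \<sigma>(2) by (intro LIMSEQ_le_const2[OF f]) blast
  ultimately show ?thesis using f[of s] by simp
qed

text \<open>For a decreasing sequence the pointwise infimum is a limit, hence convex, so here the
  infimum is attained pointwise as well.\<close>

lemma potential_tendsto_inf:
  assumes m: "range m \<subseteq> P1" and mono: "monotone (\<le>) (\<lambda>x y. le L y x) m"
    and "greatest L \<sigma> (Lower L (range m))"
  shows "(\<lambda>n. p (m n) s) \<longlonglongrightarrow> p \<sigma> s"
proof -
  have \<sigma>: "\<sigma> \<in> P1" "\<And>n s. p \<sigma> s \<le> p (m n) s" "\<And>\<nu> s. \<lbrakk>\<nu> \<in> P1; \<And>n s. p \<nu> s \<le> p (m n) s\<rbrakk> \<Longrightarrow> p \<nu> s \<le> p \<sigma> s"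
    using assms by (auto simp: greatest_iff Lower_iff)
  have dec: "decseq (\<lambda>n. p (m n) s)" for s
    using mono by (auto simp: decseq_def monotone_def order_simps)
  have "\<exists>l. (\<lambda>n. p (m n) s) \<longlonglongrightarrow> l" for s
    using decseq_convergent[OF dec, of "p \<sigma> s" s] \<sigma>(2) by metis
  then obtain f where f: "\<And>s. (\<lambda>n. p (m n) s) \<longlonglongrightarrow> f s" by metis
  have "p (m n) s \<le> p (m 0) s" for n s using dec[of s] by (auto simp: decseq_def)
  then obtain \<tau> where \<tau>: "\<tau> \<in> P1" "p \<tau> = f"
    using potential_of_limit[of m \<sigma> "m 0" f] m \<sigma> f by blast
  have "f s \<le> p (m n) s" for n s by (rule decseq_ge[OF dec f])
  then have "f s \<le> p \<sigma> s" using \<sigma>(3)[OF \<tau>(1)] \<tau>(2) by simp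
  moreover have "p \<sigma> s \<le> f s" using \<sigma>(2) by (intro LIMSEQ_le_const[OF f]) blast
  ultimately show ?thesis using f[of s] by simp
qed

text \<open>A chain cofinal for a countable \<open>C\<close> with the upper bounds of
  \<open>M\<close> has the same supremum as \<open>M\<close>. The passage to Wasserstein convergence
  is kept as the hypothesis \<open>W1\<close>, because it rests on a bound in the other
  order.\<close>

lemma directed_up_W1_tendsto:
  assumes M: "M \<subseteq> P1" "M \<noteq> {}" and "bdd_above_in L M" "directed_up L M"
    and W1: "\<And>m \<sigma>. \<lbrakk>range m \<subseteq> M; \<sigma> \<in> P1; \<And>s. (\<lambda>n. p (m n) s) \<longlonglongrightarrow> p \<sigma> s\<rbrakk> \<Longrightarrow> W1_tendsto m \<sigma>"
  shows "\<exists>\<sigma> m. least L \<sigma> (Upper L M) \<and> range m \<subseteq> M \<and> monotone (\<le>) (le L) m \<and>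
    W1_tendsto m \<sigma>"
proof -
  obtain \<sigma> where \<sigma>: "least L \<sigma> (Upper L M)" using ex_least_Upper assms by blast
  obtain C where C: "C \<subseteq> M" "countable C" "Upper L C = Upper L M" using countable_Upper M by blast
  obtain \<mu> where \<mu>: "\<mu> \<in> M" using M by blast
  \<comment> \<open>Inserting \<open>\<mu>\<close> makes the set nonempty, as an enumeration
    requires; \<open>C\<close> itself might be empty.\<close>
  obtain m :: "nat \<Rightarrow> real measure" where m: "range m \<subseteq> M" "monotone (\<le>) (le L) m" "\<forall>c\<in>insert \<mu> C. \<exists>n. le L c (m n)"
    using directed_up_chain[of M L "insert \<mu> C"] lattice_axioms assms C \<mu> by (auto simp: order_simps)
  have "Upper L (range m) \<subseteq> Upper L C"
  proof
    fix \<nu> assume "\<nu> \<in> Upper L (range m)"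
    then have \<nu>: "\<nu> \<in> P1" "\<And>n s. p (m n) s \<le> p \<nu> s" using m(1) M by (auto simp: Upper_iff)
    have "p c s \<le> p \<nu> s" if "c \<in> C" for c s
    proof -
      obtain n where "p c s \<le> p (m n) s" using m(3) \<open>c \<in> C\<close> unfolding order_simps by blast
      then show ?thesis using \<nu>(2) by (rule order_trans)
    qed
    then show "\<nu> \<in> Upper L C" using \<nu>(1) C(1) M by (auto simp: Upper_iff)
  qed
  moreover have "Upper L M \<subseteq> Upper L (range m)" using m(1) by (auto simp: Upper_def)
  ultimately have lim: "least L \<sigma> (Upper L (range m))" using \<sigma> C(3) by simp
  have "(\<lambda>n. p (m n) s) \<longlonglongrightarrow> p \<sigma> s" for s
    using m(1) M(1) by (intro potential_tendsto_sup[OF _ m(2) lim]) (rule order_trans)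
  moreover have "\<sigma> \<in> P1" using \<sigma> unfolding least_iff by blast
  ultimately have "W1_tendsto m \<sigma>" using m(1) by (intro W1)
  with \<sigma> m(1,2) show ?thesis by (intro exI[of _ \<sigma>] exI[of _ m] conjI)
qed

lemma directed_down_W1_tendsto:
  assumes M: "M \<subseteq> P1" "M \<noteq> {}" and "bdd_below_in L M" "directed_down L M"
    and W1: "\<And>m \<sigma>. \<lbrakk>range m \<subseteq> M; \<sigma> \<in> P1; \<And>s. (\<lambda>n. p (m n) s) \<longlonglongrightarrow> p \<sigma> s\<rbrakk> \<Longrightarrow> W1_tendsto m \<sigma>"
  shows "\<exists>\<sigma> m. greatest L \<sigma> (Lower L M) \<and> range m \<subseteq> M \<and> monotone (\<le>) (\<lambda>x y. le L y x) m \<and>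
    W1_tendsto m \<sigma>"
proof -
  obtain \<sigma> where \<sigma>: "greatest L \<sigma> (Lower L M)" using ex_greatest_Lower assms by blast
  obtain C where C: "C \<subseteq> M" "countable C" "Lower L C = Lower L M" using countable_Lower M by blast
  obtain \<mu> where \<mu>: "\<mu> \<in> M" using M by blast
  \<comment> \<open>The chain is built in the dual lattice, where it increases.\<close>
  have "directed_up (inv_gorder L) M"
    using assms(4) by (simp add: directed_up_def directed_down_def)
  then obtain m :: "nat \<Rightarrow> real measure" where m: "range m \<subseteq> M" "monotone (\<le>) (\<lambda>x y. le L y x) m" "\<forall>c\<in>insert \<mu> C. \<exists>n. le L (m n) c"
    using directed_up_chain[OF _ _ _ _ _ dual_lattice, of M "insert \<mu> C"] M C \<mu> by (auto simp: order_simps)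
  have "Lower L (range m) \<subseteq> Lower L C"
  proof
    fix \<nu> assume "\<nu> \<in> Lower L (range m)"
    then have \<nu>: "\<nu> \<in> P1" "\<And>n s. p \<nu> s \<le> p (m n) s" using m(1) M by (auto simp: Lower_iff)
    have "p \<nu> s \<le> p c s" if "c \<in> C" for c s
    proof -
      obtain n where "p (m n) s \<le> p c s" using m(3) \<open>c \<in> C\<close> unfolding order_simps by blast
      with \<nu>(2) show ?thesis by (rule order_trans)
    qed
    then show "\<nu> \<in> Lower L C" using \<nu>(1) C(1) M by (auto simp: Lower_iff)
  qed
  moreover have "Lower L M \<subseteq> Lower L (range m)" using m(1) by (auto simp: Lower_def)
  ultimately have lim: "greatest L \<sigma> (Lower L (range m))" using \<sigma> C(3) by simp
  have "(\<lambda>n. p (m n) s) \<longlonglongrightarrow> p \<sigma> s" for s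
    using m(1) M(1) by (intro potential_tendsto_inf[OF _ m(2) lim]) (rule order_trans)
  moreover have "\<sigma> \<in> P1" using \<sigma> unfolding greatest_iff by blast
  ultimately have "W1_tendsto m \<sigma>" using m(1) by (intro W1)
  with \<sigma> m(1,2) show ?thesis by (intro exI[of _ \<sigma>] exI[of _ m] conjI)
qed

end

section \<open>The two orders\<close>

lemma return_P1: "return borel c \<in> P1"
  and lower_pot_return: "lower_pot (return borel c) s = max (s - c) 0"
  and upper_part_return: "upper_part (return borel c) s = max (c - s) 0"
proof -
  interpret prob_space "return borel c" by (rule prob_space_return) simp
  have "real_distribution (return borel c)" by unfold_locales auto
  moreover have "integrable (return borel c) (\<lambda>x. \<bar>x\<bar>)"
    by (subst integrable_cong_AE[where g = "\<lambda>_. \<bar>c\<bar>"]) (auto simp: AE_return)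
  ultimately show "return borel c \<in> P1" by (simp add: P1_def)
  show "lower_pot (return borel c) s = max (s - c) 0" "upper_part (return borel c) s = max (c - s) 0"
    unfolding lower_pot_def upper_part_def by (simp_all add: integral_return)
qed

text \<open>Jensen's inequality for the Dirac mass. Together with its counterpart for
  \<open>upper_part\<close>, it turns bounds on means into lower bounds in the potential
  orders.\<close>

lemma lower_pot_return_le:
  assumes "\<mu> \<in> P1" "(\<integral>x. x \<partial>\<mu>) \<le> c"
  shows "lower_pot (return borel c) s \<le> lower_pot \<mu> s"
  using lower_pot_ge[OF assms(1), of s] lower_pot_nonneg[of \<mu> s] assms(2)
  by (simp add: lower_pot_return)

lemma upper_part_return_le:
  assumes "\<mu> \<in> P1" "c \<le> (\<integral>x. x \<partial>\<mu>)"
  shows "upper_part (return borel c) s \<le> upper_part \<mu> s"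
  using upper_part_eq[OF assms(1), of s] lower_pot_nonneg[of \<mu> s] upper_part_nonneg[of \<mu> s] assms(2)
  by (simp add: upper_part_return)

lemma convex_on_max:
  fixes f g :: "'a::real_vector \<Rightarrow> real"
  assumes "convex_on S f" "convex_on S g"
  shows "convex_on S (\<lambda>x. max (f x) (g x))"
proof (rule convex_onI)
  fix t :: real and x y assume t: "0 < t" "t < 1" and xy: "x \<in> S" "y \<in> S"
  let ?r = "(1 - t) * max (f x) (g x) + t * max (f y) (g y)"
  have "(1 - t) * f x + t * f y \<le> ?r" "(1 - t) * g x + t * g y \<le> ?r"
    using t by (auto intro!: add_mono mult_left_mono)
  then show "max (f ((1 - t) *\<^sub>R x + t *\<^sub>R y)) (g ((1 - t) *\<^sub>R x + t *\<^sub>R y)) \<le> ?r"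
    using convex_onD[OF assms(1), of t x y] convex_onD[OF assms(2), of t x y] t xy by auto
qed (use assms convex_on_imp_convex in blast)

lemma convex_on_uminus:
  fixes f :: "real \<Rightarrow> real"
  assumes "convex_on UNIV f"
  shows "convex_on UNIV (\<lambda>x. f (- x))"
proof (rule convex_onI)
  fix t x y :: real assume t: "0 < t" "t < 1"
  have "- ((1 - t) *\<^sub>R x + t *\<^sub>R y) = (1 - t) *\<^sub>R (- x) + t *\<^sub>R (- y)" by simp
  then show "f (- ((1 - t) *\<^sub>R x + t *\<^sub>R y)) \<le> (1 - t) * f (- x) + t * f (- y)"
    using convex_onD[OF assms, of t "- x" "- y"] t by simp
qed simp

interpretation lower: potential lower_pot
proof
  fix \<mu> \<nu> assume P: "\<mu> \<in> P1" "\<nu> \<in> P1"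
  show "\<mu> = \<nu>" if "lower_pot \<mu> = lower_pot \<nu>" using P that by (rule lower_pot_inj)
  show "\<exists>\<sigma>\<in>P1. lower_pot \<sigma> = f"
    if f: "convex_on UNIV f" "\<And>s. lower_pot \<mu> s \<le> f s" "\<And>s. f s \<le> lower_pot \<nu> s" for f
  \<comment> \<open>The enclosing potentials of \<open>\<mu>\<close> and \<open>\<nu>\<close> give
    the decay at minus infinity and the two growth constants.\<close>
  proof (rule lower_pot_exists[OF f(1)])
    show "(f \<longlongrightarrow> 0) at_bot"
      by (rule tendsto_sandwich[OF _ _ lower_pot_at_bot[OF P(1)] lower_pot_at_bot[OF P(2)]])
        (simp_all add: f)
    show "s - (\<integral>x. x \<partial>\<mu>) \<le> f s" for s
      using lower_pot_ge[OF P(1)] f(2) by (rule order_trans)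
    show "f s \<le> s + lower_pot \<nu> 0" if "0 \<le> s" for s
      using f(3) lower_pot_le[OF P(2) that] by (rule order_trans)
  qed
  \<comment> \<open>No common upper bound is available yet for \<open>between\<close>, so the
    maximum is shown to be a potential from its growth directly.\<close>
  have "\<exists>\<sigma>\<in>P1. lower_pot \<sigma> = (\<lambda>s. max (lower_pot \<mu> s) (lower_pot \<nu> s))"
  proof (rule lower_pot_exists)
    show "convex_on UNIV (\<lambda>s. max (lower_pot \<mu> s) (lower_pot \<nu> s))"
      by (intro convex_on_max lower_pot_convex P)
    show "((\<lambda>s. max (lower_pot \<mu> s) (lower_pot \<nu> s)) \<longlongrightarrow> 0) at_bot"
      using tendsto_max[OF lower_pot_at_bot[OF P(1)] lower_pot_at_bot[OF P(2)]] by simp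
    show "s - (\<integral>x. x \<partial>\<mu>) \<le> max (lower_pot \<mu> s) (lower_pot \<nu> s)" for s
      using lower_pot_ge[OF P(1), of s] by simp
    show "max (lower_pot \<mu> s) (lower_pot \<nu> s) \<le> s + max (lower_pot \<mu> 0) (lower_pot \<nu> 0)" if "0 \<le> s" for s
      using lower_pot_le[OF P(1) that] lower_pot_le[OF P(2) that] by linarith
  qed
  then show "\<exists>\<eta>\<in>P1. \<forall>s. lower_pot \<mu> s \<le> lower_pot \<eta> s \<and> lower_pot \<nu> s \<le> lower_pot \<eta> s"
    by (metis max.cobounded1 max.cobounded2)
  \<comment> \<open>A Dirac mass at the larger of the two means lies below both.\<close>
  show "\<exists>\<eta>\<in>P1. \<forall>s. lower_pot \<eta> s \<le> lower_pot \<mu> s \<and> lower_pot \<eta> s \<le> lower_pot \<nu> s"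
    by (rule bexI[of _ "return borel (max (\<integral>x. x \<partial>\<mu>) (\<integral>x. x \<partial>\<nu>))"])
      (auto intro!: lower_pot_return_le P return_P1)
qed (rule lower_pot_convex)

text \<open>Everything is transported through \<open>reflect\<close>: replacing \<open>s\<close> by
  \<open>- s\<close> preserves convexity and pointwise comparison.\<close>

interpretation upper: potential upper_part
proof
  have eq: "upper_part \<mu> s = lower_pot (reflect \<mu>) (- s)" if "\<mu> \<in> P1" for \<mu> s
    by (simp add: lower_pot_reflect that)
  fix \<mu> assume \<mu>: "\<mu> \<in> P1"
  show "convex_on UNIV (upper_part \<mu>)"
    using convex_on_uminus[OF lower_pot_convex[OF reflect_P1(1)[OF \<mu>]]] by (simp add: eq[OF \<mu>, symmetric])
  fix \<nu> assume \<nu>: "\<nu> \<in> P1"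
  note P = \<mu> \<nu>
  note R = P[THEN reflect_P1(1)]
  show "\<mu> = \<nu>" if "upper_part \<mu> = upper_part \<nu>"
  proof -
    have "lower_pot (reflect \<mu>) = lower_pot (reflect \<nu>)"
      by (simp add: fun_eq_iff lower_pot_reflect P that)
    then have "reflect \<mu> = reflect \<nu>" by (rule lower_pot_inj[OF R])
    then show ?thesis using P reflect_P1(2) by metis
  qed
  show "\<exists>\<sigma>\<in>P1. upper_part \<sigma> = f"
    if f: "convex_on UNIV f" "\<And>s. upper_part \<mu> s \<le> f s" "\<And>s. f s \<le> upper_part \<nu> s" for f
  proof -
    obtain \<sigma> where "\<sigma> \<in> P1" "lower_pot \<sigma> = (\<lambda>s. f (- s))"
      using lower.between[OF R convex_on_uminus[OF f(1)]] f(2,3) by (auto simp: lower_pot_reflect P)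
    then show ?thesis
      by (intro bexI[of _ "reflect \<sigma>"]) (auto simp: reflect_P1 fun_eq_iff)
  qed
  obtain \<eta> where \<eta>: "\<eta> \<in> P1"
    "\<And>s. lower_pot (reflect \<mu>) s \<le> lower_pot \<eta> s" "\<And>s. lower_pot (reflect \<nu>) s \<le> lower_pot \<eta> s"
    using lower.upper[OF R] by blast
  show "\<exists>\<eta>\<in>P1. \<forall>s. upper_part \<mu> s \<le> upper_part \<eta> s \<and> upper_part \<nu> s \<le> upper_part \<eta> s"
    by (rule bexI[OF _ reflect_P1(1)[OF \<eta>(1)]])
      (use \<eta>(2,3)[of "- s" for s] in \<open>simp add: upper_part_reflect \<eta>(1) lower_pot_reflect P\<close>)
  obtain \<theta> where \<theta>: "\<theta> \<in> P1"
    "\<And>s. lower_pot \<theta> s \<le> lower_pot (reflect \<mu>) s" "\<And>s. lower_pot \<theta> s \<le> lower_pot (reflect \<nu>) s"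
    using lower.lower[OF R] by blast
  show "\<exists>\<eta>\<in>P1. \<forall>s. upper_part \<eta> s \<le> upper_part \<mu> s \<and> upper_part \<eta> s \<le> upper_part \<nu> s"
    by (rule bexI[OF _ reflect_P1(1)[OF \<theta>(1)]])
      (use \<theta>(2,3)[of "- s" for s] in \<open>simp add: upper_part_reflect \<theta>(1) lower_pot_reflect P\<close>)
qed

lemma icx_eq: "icx = potential_order upper_part"
  by (simp add: icx_def potential_order_def)

text \<open>The sign change from \<open>lower_part\<close> to \<open>lower_pot\<close> reverses the
  order, so suprema for \<open>icv\<close> are infima of the potential order.\<close>

lemma icv_eq: "icv = inv_gorder (potential_order lower_pot)"
  by (simp add: icv_def potential_order_def lower_part_eq)

lemma directed_dual:
  "directed_up (inv_gorder L) M \<longleftrightarrow> directed_down L M"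
  "directed_down (inv_gorder L) M \<longleftrightarrow> directed_up L M"
  by (simp_all add: directed_up_def directed_down_def)

section \<open>Sets bounded in both orders\<close>

context
  fixes M :: "real measure set" and \<alpha> \<beta> :: "real measure"
  assumes M: "M \<subseteq> P1" "M \<noteq> {}" and \<alpha>: "\<alpha> \<in> Upper lower.L M" and \<beta>: "\<beta> \<in> Upper upper.L M"
begin

lemma bounds:
  "\<alpha> \<in> P1" "\<And>\<mu> s. \<mu> \<in> M \<Longrightarrow> lower_pot \<mu> s \<le> lower_pot \<alpha> s"
  "\<beta> \<in> P1" "\<And>\<mu> s. \<mu> \<in> M \<Longrightarrow> upper_part \<mu> s \<le> upper_part \<beta> s"
  using \<alpha> \<beta> M(1) by (auto simp: lower.Upper_iff upper.Upper_iff)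

text \<open>The mean is \<open>upper_part \<mu> 0 - lower_pot \<mu> 0\<close>, a difference of two
  nonnegative terms, each bounded over \<open>M\<close>.\<close>

lemma mean_bounds:
  assumes "\<mu> \<in> M"
  shows "- lower_pot \<alpha> 0 \<le> (\<integral>x. x \<partial>\<mu>)" "(\<integral>x. x \<partial>\<mu>) \<le> upper_part \<beta> 0"
proof -
  have "\<mu> \<in> P1" using assms M by blast
  from upper_part_eq[OF this, of 0]
  show "- lower_pot \<alpha> 0 \<le> (\<integral>x. x \<partial>\<mu>)" "(\<integral>x. x \<partial>\<mu>) \<le> upper_part \<beta> 0"
    using bounds(2,4)[OF assms, of 0] lower_pot_nonneg[of \<mu> 0] upper_part_nonneg[of \<mu> 0] by auto
qed

text \<open>The missing lower bounds are Dirac masses placed at the two ends of the range allowed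
  for the means.\<close>

lemma bdd:
  "bdd_above_in lower.L M" "bdd_below_in lower.L M" "bdd_above_in upper.L M" "bdd_below_in upper.L M"
proof -
  have "return borel (upper_part \<beta> 0) \<in> Lower lower.L M"
    using M(1) by (auto simp: lower.Lower_iff return_P1 intro!: lower_pot_return_le mean_bounds)
  moreover have "return borel (- lower_pot \<alpha> 0) \<in> Lower upper.L M"
    using M(1) by (auto simp: upper.Lower_iff return_P1 intro!: upper_part_return_le mean_bounds)
  ultimately show "bdd_above_in lower.L M" "bdd_below_in lower.L M"
    "bdd_above_in upper.L M" "bdd_below_in upper.L M"
    using \<alpha> \<beta> unfolding bdd_above_in_def bdd_below_in_def by blast+
qed

text \<open>The bound \<open>\<beta>\<close> from the other order upgrades convergence of lower
  potentials to convergence of upper parts.\<close>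

lemma W1_tendsto_lower:
  assumes "range m \<subseteq> M" "\<sigma> \<in> P1" "\<And>s. (\<lambda>n. lower_pot (m n) s) \<longlonglongrightarrow> lower_pot \<sigma> s"
  shows "W1_tendsto m \<sigma>"
proof -
  have m: "m n \<in> M" "m n \<in> P1" for n using assms(1) M(1) by auto
  show ?thesis
    by (rule W1_tendsto_potentials[OF m(2) assms(2,3)
          upper_part_tendsto[OF m(2) assms(2) bounds(3) assms(3) bounds(4)[OF m(1)]]])
qed

lemma W1_tendsto_upper:
  assumes "range m \<subseteq> M" "\<sigma> \<in> P1" "\<And>s. (\<lambda>n. upper_part (m n) s) \<longlonglongrightarrow> upper_part \<sigma> s"
  shows "W1_tendsto m \<sigma>"
proof -
  have m: "m n \<in> M" "m n \<in> P1" for n using assms(1) M(1) by auto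
  show ?thesis
    by (rule W1_tendsto_potentials[OF m(2) assms(2)
          lower_pot_tendsto[OF m(2) assms(2) bounds(1) assms(3) bounds(2)[OF m(1)]] assms(3)])
qed

lemmas directed_W1_tendsto =
  lower.directed_up_W1_tendsto[OF M bdd(1) _ W1_tendsto_lower]
  lower.directed_down_W1_tendsto[OF M bdd(2) _ W1_tendsto_lower]
  upper.directed_up_W1_tendsto[OF M bdd(3) _ W1_tendsto_upper]
  upper.directed_down_W1_tendsto[OF M bdd(4) _ W1_tendsto_upper]

end

theorem proposition3p9:
  shows "(dedekind_super_complete icv \<and> dedekind_super_complete icx) \<and>
    (\<forall>M \<subseteq> P1. M \<noteq> {} \<and> bdd_below_in icv M \<and> bdd_above_in icx M \<longrightarrow>
      (\<forall>L \<in> {icv, icx}.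
        (directed_up L M \<longrightarrow>
          (\<exists>\<mu> m. least L \<mu> (Upper L M) \<and> range m \<subseteq> M \<and> monotone (\<le>) (le L) m \<and>
             W1_tendsto m \<mu>)) \<and>
        (directed_down L M \<longrightarrow>
          (\<exists>\<mu> m. greatest L \<mu> (Lower L M) \<and> range m \<subseteq> M \<and>
             monotone (\<le>) (\<lambda>x y. le L y x) m \<and> W1_tendsto m \<mu>))))"
proof (intro conjI allI impI ballI)
  show "dedekind_super_complete icv"
    unfolding icv_eq by (rule inv_gorder_dedekind_super_complete[OF lower.dedekind_super_complete])
  show "dedekind_super_complete icx"
    unfolding icx_eq by (rule upper.dedekind_super_complete)
next
  fix M L
  assume M: "M \<subseteq> P1" "M \<noteq> {} \<and> bdd_below_in icv M \<and> bdd_above_in icx M" and L: "L \<in> {icv, icx}"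
  obtain \<alpha> \<beta> where "\<alpha> \<in> Upper lower.L M" "\<beta> \<in> Upper upper.L M"
    using M(2) unfolding bdd_below_in_def bdd_above_in_def icv_eq icx_eq Lower_dual by blast
  note W1 = directed_W1_tendsto[OF M(1) _ this, OF M(2)[THEN conjunct1]]
  have dual: "le (inv_gorder K) = (\<lambda>x y. le K y x)" for K :: "real measure gorder" by simp
  from L consider "L = icv" | "L = icx" by blast
  note cases = this
  show "\<exists>\<mu> m. least L \<mu> (Upper L M) \<and> range m \<subseteq> M \<and> monotone (\<le>) (le L) m \<and> W1_tendsto m \<mu>"
    if "directed_up L M"
    using cases
  proof cases
    \<comment> \<open>By order reversal, a set directed upwards for \<open>icv\<close> is directed
      downwards for \<open>lower.L\<close>, so the statement on infima applies.\<close>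
    case 1
    show ?thesis
      using W1(2) that unfolding 1 icv_eq directed_dual least_dual Upper_dual dual by blast
  next
    case 2
    show ?thesis using W1(3) that unfolding 2 icx_eq by blast
  qed
  show "\<exists>\<mu> m. greatest L \<mu> (Lower L M) \<and> range m \<subseteq> M \<and> monotone (\<le>) (\<lambda>x y. le L y x) m \<and> W1_tendsto m \<mu>"
    if "directed_down L M"
    using cases
  proof cases
    case 1
    show ?thesis
      using W1(1) that unfolding 1 icv_eq directed_dual greatest_dual Lower_dual dual by blast
  next
    case 2
    show ?thesis using W1(4) that unfolding 2 icx_eq by blast
  qed
qed

end
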